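(* Let $X,V$ be complex Hilbert spaces, let $A_0$ be the generator of a unitary group $(T_0(t))_{t\in\mathbb{R}}$ on $X$, let $B\in L^2_{\mathrm{loc}}(\mathbb{R}_+;\mathcal{B}(V,X))$, and let $A(t)=A_0-B(t)B(t)^*$, $D(A(t))=D(A_0)$, $t\ge0$, with associated evolution family of contractions $(U(t,s))_{t\ge s\ge0}$. Suppose that $T_0(\tau)=I$ for some $\tau>0$ and let $T=U(\tau,0)$. Then $T$ is a Ritt operator and $$\operatorname{Fix}T=\left\{x\in X:\int_0^\tau\|B(t)^*T_0(t)x\|^2\,dt=0\right\}.$$ In particular, $\sigma(T)\cap\mathbb{T}\subseteq\{1\}$, and $1\notin\sigma_p(T)$ if and only if $(B^*,A_0)$ is approximately observable on $(0,\tau)$.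
   Context: An evolution family on $X$ is a family $(U(t,s))_{t\ge s\ge0}$ in $\mathcal{B}(X)$ with $U(t,t)=I$, $U(t,r)U(r,s)=U(t,s)$ for $t\ge r\ge s\ge0$, and $(t,s)\mapsto U(t,s)x$ continuous for every $x\in X$. The evolution family of contractions associated with $A(t)=A_0-B(t)B(t)^*$ is the one for which, for every $x\in X$, $z(t)=U(t,0)x$ satisfies $$z(t)=T_0(t)x-\int_0^tT_0(t-s)B(s)B(s)^*z(s)\,ds,\quad t\ge0;$$ such a family exists. A bounded operator $T$ is a Ritt operator if its spectral radius satisfies $r(T)\le1$ and there is a constant $C>0$ such that $\|R(\lambda,T)\|\le C/|\lambda-1|$ for all $|\lambda|>1$, where $R(\lambda,T)=(\lambda-T)^{-1}$. Further, $\operatorname{Fix}T=\operatorname{Ker}(I-T)$, $\sigma(T)$ and $\sigma_p(T)$ are the spectrum and point spectrum, and $\mathbb{T}$ is the unit circle in $\mathbb{C}$. The pair $(B^*,A_0)$ is approximately observable on $(0,\tau)$ if for $x\in X$ the condition $\int_0^\tau\|B(t)^*T_0(t)x\|^2\,dt=0$ implies $x=0$. *)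

theory Defs
  imports "HOL-Analysis.Analysis"
begin

section \<open>Complex Hilbert spaces\<close>

text \<open>
  The underlying real Hilbert space structure (and in particular the norm) is inherited from
  \<^class>\<open>real_inner\<close>; its real inner product is the real part of the complex one, so that
  the norm of \<open>x\<close> is the square root of \<open>cinner x x\<close>.  The complex inner product is linear in
  its first argument.
\<close>

class complex_hilbert_space = real_inner + complete_space +
  fixes scaleC :: "complex \<Rightarrow> 'a \<Rightarrow> 'a"  (infixr \<open>*\<^sub>C\<close> 75)
    and cinner :: "'a \<Rightarrow> 'a \<Rightarrow> complex"
  assumes scaleC_add_right: "a *\<^sub>C (x + y) = a *\<^sub>C x + a *\<^sub>C y"
    and scaleC_add_left: "(a + b) *\<^sub>C x = a *\<^sub>C x + b *\<^sub>C x"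
    and scaleC_scaleC: "a *\<^sub>C b *\<^sub>C x = (a * b) *\<^sub>C x"
    and scaleC_of_real: "complex_of_real r *\<^sub>C x = r *\<^sub>R x"
    and cinner_commute: "cinner x y = cnj (cinner y x)"
    and cinner_add_left: "cinner (x + y) z = cinner x z + cinner y z"
    and cinner_scaleC_left: "cinner (a *\<^sub>C x) y = a * cinner x y"
    and inner_eq_Re_cinner: "inner x y = Re (cinner x y)"

instantiation complex :: complex_hilbert_space
begin

definition scaleC_complex :: "complex \<Rightarrow> complex \<Rightarrow> complex" where
  "scaleC_complex a x = a * x"

definition cinner_complex :: "complex \<Rightarrow> complex \<Rightarrow> complex" where
  "cinner_complex x y = x * cnj y"

instance
  by standard
     (auto simp: scaleC_complex_def cinner_complex_def algebra_simps scaleR_conv_of_real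
        inner_complex_def)

end


section \<open>Bounded operators\<close>

text \<open>
  \<open>\<B>(V,X)\<close> is rendered as the set of complex-linear elements of the type
  \<open>'v \<Rightarrow>\<^sub>L 'x\<close> of bounded real-linear operators, with the same (operator) norm.
\<close>

definition complex_linear ::
  "('a::complex_hilbert_space \<Rightarrow>\<^sub>L 'b::complex_hilbert_space) \<Rightarrow> bool" where
  "complex_linear f \<longleftrightarrow> (\<forall>c x. blinfun_apply f (c *\<^sub>C x) = c *\<^sub>C blinfun_apply f x)"

text \<open>The Hilbert space adjoint; it exists and is unique, see \<open>cinner_cadjoint\<close> below.\<close>

definition cadjoint ::
  "('a::complex_hilbert_space \<Rightarrow>\<^sub>L 'b::complex_hilbert_space) \<Rightarrow> ('b \<Rightarrow>\<^sub>L 'a)" where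
  "cadjoint f = (THE g. \<forall>x y. cinner (blinfun_apply f x) y = cinner x (blinfun_apply g y))"

definition unitary_operator :: "('a::complex_hilbert_space \<Rightarrow>\<^sub>L 'a) \<Rightarrow> bool" where
  "unitary_operator u \<longleftrightarrow> complex_linear u \<and>
     cadjoint u o\<^sub>L u = id_blinfun \<and> u o\<^sub>L cadjoint u = id_blinfun"


subsection \<open>Existence of the adjoint\<close>

lemma riesz_representation_exists:
  fixes f :: "'a::{real_inner, complete_space} \<Rightarrow> real"
  assumes "bounded_linear f"
  shows "\<exists>u. \<forall>x. f x = inner x u"
proof -
  interpret f: bounded_linear f by fact
  define J where "J x = 2 * f x - inner x x" for x
  obtain K where K: "\<And>x. norm (f x) \<le> norm x * K" using f.bounded by blast
  have Jle: "J x \<le> K\<^sup>2" for x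
  proof -
    have "f x \<le> norm x * K" using K[of x] by simp
    moreover have "0 \<le> (norm x - K)\<^sup>2" by simp
    ultimately show ?thesis
      by (simp add: J_def power2_norm_eq_inner[symmetric] power2_eq_square algebra_simps)
  qed
  define S where "S = (SUP x. J x)"
  have bdd: "bdd_above (range J)" using Jle by (auto intro!: bdd_aboveI)
  have J_S: "J x \<le> S" for x unfolding S_def using bdd by (simp add: cSUP_upper)
  have "\<exists>x. S - inverse (Suc n) < J x" for n
    using less_cSUP_iff[of UNIV J "S - inverse (Suc n)"] bdd unfolding S_def by auto
  then obtain X where X: "\<And>n. S - inverse (Suc n) < J (X n)" by metis
  have mid: "J ((1/2) *\<^sub>R (x + y)) = (J x + J y) / 2 + (norm (x - y))\<^sup>2 / 4" for x y
    by (simp add: J_def f.scaleR f.add power2_norm_eq_inner inner_commute[of y x]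
        algebra_simps)
       (simp add: field_simps)
  have near: "(norm (X m - X n))\<^sup>2 \<le> 2 * (inverse (Suc m) + inverse (Suc n))" for m n
  proof -
    have "c \<le> 2 * (a + b)"
      if "j = (p + q) / 2 + c / 4" "j \<le> S" "S - a < p" "S - b < q" for a b c j p q :: real
      using that by (simp add: field_simps)
    then show ?thesis
      using mid[of "X m" "X n"] J_S[of "(1/2) *\<^sub>R (X m + X n)"] X[of m] X[of n] by blast
  qed
  have "Cauchy X"
  proof (rule metric_CauchyI)
    fix e :: real assume e: "0 < e"
    obtain N where N: "inverse (Suc N) < e\<^sup>2 / 4"
      using reals_Archimedean[of "e\<^sup>2 / 4"] e by auto
    have "dist (X m) (X n) < e" if "m \<ge> N" "n \<ge> N" for m n
    proof -
      have "inverse (Suc m) \<le> inverse (Suc N)" "inverse (Suc n) \<le> inverse (Suc N)"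
        using that by (simp_all add: field_simps)
      moreover have "p < q" if "c < q / 4" "p \<le> 2 * (a + b)" "a \<le> c" "b \<le> c" for a b c p q :: real
        using that by simp
      ultimately have "(norm (X m - X n))\<^sup>2 < e\<^sup>2" using N near[of m n] by blast
      then show ?thesis using e by (simp add: dist_norm power2_less_imp_less)
    qed
    then show "\<exists>M. \<forall>m\<ge>M. \<forall>n\<ge>M. dist (X m) (X n) < e" by blast
  qed
  then obtain u where u: "X \<longlonglongrightarrow> u" using Cauchy_convergent convergent_def by blast
  have "(\<lambda>n. J (X n)) \<longlonglongrightarrow> J u" unfolding J_def by (intro tendsto_intros f.tendsto u)
  moreover have "(\<lambda>n. S - inverse (real (Suc n))) \<longlonglongrightarrow> S - 0"
    by (intro tendsto_intros LIMSEQ_inverse_real_of_nat)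
  ultimately have "S \<le> J u"
    using X by (intro LIMSEQ_le[of "\<lambda>n. S - inverse (real (Suc n))" S "\<lambda>n. J (X n)" "J u"])
      (simp_all add: less_imp_le del: of_nat_Suc)
  then have max: "J x \<le> J u" for x using J_S[of x] by linarith
  have "f x = inner x u" for x
  proof (rule ccontr)
    assume ne: "f x \<noteq> inner x u"
    define d where "d = f x - inner x u"
    have ineq: "2 * t * d \<le> t\<^sup>2 * inner x x" for t
      using max[of "u + t *\<^sub>R x"]
      by (simp add: J_def d_def f.add f.scaleR inner_add_left inner_add_right
          inner_commute[of u x] power2_eq_square algebra_simps)
    have x0: "inner x x > 0"
      using ne f.zero by (cases "x = 0") auto
    have "2 * (d / inner x x) * d \<le> (d / inner x x)\<^sup>2 * inner x x" by (rule ineq)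
    then have "d * d \<le> 0" using x0 by (simp add: power2_eq_square field_simps)
    then show False
      using ne by (auto simp: d_def mult_le_0_iff)
  qed
  then show ?thesis by blast
qed

lemma cinner_eq_inner:
  fixes x y :: "'a::complex_hilbert_space"
  shows "cinner x y = Complex (inner x y) (inner ((- \<i>) *\<^sub>C x) y)"
  by (simp add: complex_eq_iff inner_eq_Re_cinner cinner_scaleC_left)

lemma cadjoint_exists1:
  fixes f :: "'a::complex_hilbert_space \<Rightarrow>\<^sub>L 'b::complex_hilbert_space"
  assumes "complex_linear f"
  shows "\<exists>!g. \<forall>x y. cinner (blinfun_apply f x) y = cinner x (blinfun_apply g y)"
proof -
  have "\<exists>u. \<forall>x. inner (blinfun_apply f x) y = inner x u" for y
    by (intro riesz_representation_exists bounded_linear_inner_left_comp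
        blinfun.bounded_linear_right)
  then obtain g where g: "\<And>x y. inner (blinfun_apply f x) y = inner x (g y)" by metis
  have eqI: "a = b" if "\<And>x. inner x a = inner x b" for a b :: 'a
    using that[of "a - b"] by (metis inner_diff_right inner_eq_zero_iff right_minus_eq)
  have bl: "bounded_linear g"
  proof (rule bounded_linear_intro)
    show "g (x + y) = g x + g y" for x y
      by (rule eqI) (simp add: inner_add_right flip: g)
    show "g (r *\<^sub>R x) = r *\<^sub>R g x" for r x
      by (rule eqI) (simp flip: g)
    show "norm (g x) \<le> norm x * norm f" for x
    proof (cases "g x = 0")
      case False
      have "norm (g x) * norm (g x) = inner (blinfun_apply f (g x)) x"
        by (simp add: g power2_norm_eq_inner[symmetric] power2_eq_square)
      also have "\<dots> \<le> norm (blinfun_apply f (g x)) * norm x"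
        by (rule norm_cauchy_schwarz)
      also have "\<dots> \<le> (norm f * norm (g x)) * norm x"
        by (intro mult_right_mono norm_blinfun) auto
      finally show ?thesis using False by (simp add: algebra_simps)
    qed auto
  qed
  show ?thesis
  proof (rule ex1I[of _ "Blinfun g"])
    show "\<forall>x y. cinner (blinfun_apply f x) y = cinner x (blinfun_apply (Blinfun g) y)"
      using assms
      by (simp add: bounded_linear_Blinfun_apply[OF bl] cinner_eq_inner complex_linear_def
          flip: g)
  next
    fix h assume h: "\<forall>x y. cinner (blinfun_apply f x) y = cinner x (blinfun_apply h y)"
    show "h = Blinfun g"
      by (intro blinfun_eqI eqI)
         (simp add: bounded_linear_Blinfun_apply[OF bl] inner_eq_Re_cinner h[rule_format, symmetric]
            g[unfolded inner_eq_Re_cinner, symmetric])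
  qed
qed

lemma cinner_cadjoint:
  assumes "complex_linear f"
  shows "cinner (blinfun_apply f x) y = cinner x (blinfun_apply (cadjoint f) y)"
  using theI'[OF cadjoint_exists1[OF assms]] unfolding cadjoint_def by blast


section \<open>Spectral notions\<close>

text \<open>
  The inverse of a complex-linear operator is automatically complex-linear, so for complex-linear
  \<open>T\<close> the inverses below lie in \<open>\<B>(X)\<close>.
\<close>

definition is_resolvent_at ::
  "complex \<Rightarrow> ('x::complex_hilbert_space \<Rightarrow>\<^sub>L 'x) \<Rightarrow> ('x \<Rightarrow>\<^sub>L 'x) \<Rightarrow> bool" where
  "is_resolvent_at \<mu> T R \<longleftrightarrow>
     (\<forall>x. blinfun_apply R (\<mu> *\<^sub>C x - blinfun_apply T x) = x) \<and>
     (\<forall>x. \<mu> *\<^sub>C blinfun_apply R x - blinfun_apply T (blinfun_apply R x) = x)"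

definition resolvent :: "complex \<Rightarrow> ('x::complex_hilbert_space \<Rightarrow>\<^sub>L 'x) \<Rightarrow> ('x \<Rightarrow>\<^sub>L 'x)" where
  "resolvent \<mu> T = (THE R. is_resolvent_at \<mu> T R)"

definition spectrum :: "('x::complex_hilbert_space \<Rightarrow>\<^sub>L 'x) \<Rightarrow> complex set" where
  "spectrum T = {\<mu>. \<not> (\<exists>R. is_resolvent_at \<mu> T R)}"

definition point_spectrum :: "('x::complex_hilbert_space \<Rightarrow>\<^sub>L 'x) \<Rightarrow> complex set" where
  "point_spectrum T = {\<mu>. \<exists>x. x \<noteq> 0 \<and> blinfun_apply T x = \<mu> *\<^sub>C x}"

text \<open>
  Values in \<^typ>\<open>ennreal\<close> make the supremum over the empty spectrum (which occurs on the zero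
  space only) equal to \<open>0\<close>; the supremum of the empty set of reals is unspecified.
\<close>

definition spectral_radius :: "('x::complex_hilbert_space \<Rightarrow>\<^sub>L 'x) \<Rightarrow> ennreal" where
  "spectral_radius T = (SUP \<mu>\<in>spectrum T. ennreal (cmod \<mu>))"

definition ritt_operator :: "('x::complex_hilbert_space \<Rightarrow>\<^sub>L 'x) \<Rightarrow> bool" where
  "ritt_operator T \<longleftrightarrow> complex_linear T \<and> spectral_radius T \<le> 1 \<and>
     (\<exists>C>0. \<forall>\<mu>. cmod \<mu> > 1 \<longrightarrow> norm (resolvent \<mu> T) \<le> C / cmod (\<mu> - 1))"

definition fixed_space :: "('x::complex_hilbert_space \<Rightarrow>\<^sub>L 'x) \<Rightarrow> 'x set" where
  "fixed_space T = {x. blinfun_apply (id_blinfun - T) x = 0}"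


section \<open>Unitary groups and their generators\<close>

definition unitary_group :: "(real \<Rightarrow> 'x::complex_hilbert_space \<Rightarrow>\<^sub>L 'x) \<Rightarrow> bool" where
  "unitary_group T0 \<longleftrightarrow>
     (\<forall>t. unitary_operator (T0 t)) \<and>
     T0 0 = id_blinfun \<and>
     (\<forall>s t. T0 (s + t) = T0 s o\<^sub>L T0 t) \<and>
     (\<forall>x. continuous_on UNIV (\<lambda>t. blinfun_apply (T0 t) x))"

text \<open>Unbounded operators are represented by their graphs; the domain is \<^const>\<open>Domain\<close>.\<close>

definition group_generator ::
  "(real \<Rightarrow> 'x::complex_hilbert_space \<Rightarrow>\<^sub>L 'x) \<Rightarrow> ('x \<times> 'x) set" where
  "group_generator T0 =
     {(x, y). ((\<lambda>t. (1 / t) *\<^sub>R (blinfun_apply (T0 t) x - x)) \<longlongrightarrow> y) (at 0)}"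

definition perturbed_generator ::
  "('x \<times> 'x) set \<Rightarrow> (real \<Rightarrow> 'v::complex_hilbert_space \<Rightarrow>\<^sub>L 'x::complex_hilbert_space)
     \<Rightarrow> real \<Rightarrow> ('x \<times> 'x) set" where
  "perturbed_generator A0 B t =
     {(x, y - blinfun_apply (B t o\<^sub>L cadjoint (B t)) x) | x y. (x, y) \<in> A0}"


section \<open>Evolution families\<close>

definition strongly_measurable :: "'a measure \<Rightarrow> ('a \<Rightarrow> 'b::real_normed_vector) \<Rightarrow> bool" where
  "strongly_measurable M f \<longleftrightarrow>
     (\<exists>s. (\<forall>n. simple_function M (s n)) \<and> (AE t in M. (\<lambda>n. s n t) \<longlonglongrightarrow> f t))"

definition L2_loc ::
  "(real \<Rightarrow> 'v::complex_hilbert_space \<Rightarrow>\<^sub>L 'x::complex_hilbert_space) \<Rightarrow> bool" where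
  "L2_loc B \<longleftrightarrow>
     (\<forall>t\<ge>0. complex_linear (B t)) \<and>
     strongly_measurable (lebesgue_on {0..}) B \<and>
     (\<forall>a\<ge>0. (\<lambda>t. (norm (B t))\<^sup>2) absolutely_integrable_on {0..a})"

definition evolution_family :: "(real \<Rightarrow> real \<Rightarrow> 'x::complex_hilbert_space \<Rightarrow>\<^sub>L 'x) \<Rightarrow> bool" where
  "evolution_family U \<longleftrightarrow>
     (\<forall>t s. 0 \<le> s \<and> s \<le> t \<longrightarrow> complex_linear (U t s)) \<and>
     (\<forall>t\<ge>0. U t t = id_blinfun) \<and>
     (\<forall>t r s. 0 \<le> s \<and> s \<le> r \<and> r \<le> t \<longrightarrow> U t r o\<^sub>L U r s = U t s) \<and>
     (\<forall>x. continuous_on {(t, s). 0 \<le> s \<and> s \<le> t} (\<lambda>(t, s). blinfun_apply (U t s) x))"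

text \<open>
  The family associated with \<^term>\<open>perturbed_generator (group_generator T0) B\<close>, i.e. with
  \<open>A(t) = A\<^sub>0 - B(t) B(t)\<^sup>*\<close>, is characterised by a variation of parameters formula.
  \<^const>\<open>lebesgue_integral\<close> is only available for second countable spaces, hence the
  use of \<^const>\<open>has_integral\<close>, which agrees with the Bochner integral here: the integrand is
  Bochner integrable, since \<open>B\<close> is locally square integrable and the orbits of \<open>U\<close> are continuous.
\<close>

definition associated_evolution_family ::
  "(real \<Rightarrow> 'x::complex_hilbert_space \<Rightarrow>\<^sub>L 'x) \<Rightarrow> (real \<Rightarrow> 'v::complex_hilbert_space \<Rightarrow>\<^sub>L 'x)
     \<Rightarrow> (real \<Rightarrow> real \<Rightarrow> 'x \<Rightarrow>\<^sub>L 'x) \<Rightarrow> bool" where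
  "associated_evolution_family T0 B U \<longleftrightarrow>
     evolution_family U \<and>
     (\<forall>t s. 0 \<le> s \<and> s \<le> t \<longrightarrow> norm (U t s) \<le> 1) \<and>
     (\<forall>x. \<forall>t\<ge>0. \<exists>I.
        ((\<lambda>s. blinfun_apply (T0 (t - s) o\<^sub>L B s o\<^sub>L cadjoint (B s)) (blinfun_apply (U s 0) x))
           has_integral I) {0..t} \<and>
        blinfun_apply (U t 0) x = blinfun_apply (T0 t) x - I)"

text \<open>\<open>A\<^sub>0\<close> enters approximate observability of \<open>(B\<^sup>*, A\<^sub>0)\<close> through the group it generates.\<close>

definition approximately_observable ::
  "(real \<Rightarrow> 'v::complex_hilbert_space \<Rightarrow>\<^sub>L 'x::complex_hilbert_space)
     \<Rightarrow> (real \<Rightarrow> 'x \<Rightarrow>\<^sub>L 'x) \<Rightarrow> real \<Rightarrow> bool" where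
  "approximately_observable B T0 \<tau> \<longleftrightarrow>
     (\<forall>x. integral {0..\<tau>} (\<lambda>t. (norm (blinfun_apply (cadjoint (B t)) (blinfun_apply (T0 t) x)))\<^sup>2) = 0
        \<longrightarrow> x = 0)"

end

theory Submission
  imports Defs
begin

text \<open>
  Pass to the rotating frame \<open>w(t) = T\<^sub>0(-t) U(t,0) x\<close> and put \<open>C(s) = B(s)\<^sup>* T\<^sub>0(s)\<close>.  The variation
  of parameters formula becomes the damped equation \<open>w(t) = x - \<integral>\<^sub>0\<^sup>t C(s)\<^sup>* C(s) w(s) ds\<close>, and
  \<open>w(\<tau>) = T x\<close> because \<open>T\<^sub>0(\<tau>) = I\<close>.  Let \<open>E = \<integral>\<^sub>0\<^sup>\<tau> \<parallel>C w\<parallel>\<^sup>2\<close> be the dissipated energy.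

  Three facts about this equation carry the proof.  The energy balance
  \<open>\<parallel>x\<parallel>\<^sup>2 - \<parallel>T x\<parallel>\<^sup>2 = 2 E\<close> is \<open>energy_identity\<close>.  The Cauchy-Schwarz inequality in \<open>L\<^sup>2\<close> bounds
  \<open>\<parallel>x - w(t)\<parallel>\<^sup>2\<close> by a multiple of \<open>E\<close> (\<open>displacement_le\<close>); hence along the
  undamped orbit, too, little is observed when little is dissipated: \<open>\<integral>\<^sub>0\<^sup>\<tau> \<parallel>C x\<parallel>\<^sup>2\<close> is at most a
  multiple of \<open>E\<close> (\<open>observation_le\<close>).  Finally the defect \<open>x - T x\<close> is the integral of
  \<open>C\<^sup>* C w\<close>, so the real part of its inner product with \<open>c x\<close>, \<open>\<bar>c\<bar> = 1\<close>, is at most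
  \<open>(E + \<integral>\<^sub>0\<^sup>\<tau> \<parallel>C x\<parallel>\<^sup>2) / 2\<close>.  Together they give (\<open>loss_controls_defect\<close>)
  \<open>\<bar>\<langle>x - T x, x\<rangle>\<bar> \<le> M (\<parallel>x\<parallel>\<^sup>2 - \<parallel>T x\<parallel>\<^sup>2)\<close> with \<open>M\<close> depending only on \<open>\<integral>\<^sub>0\<^sup>\<tau> \<parallel>B\<parallel>\<^sup>2\<close>.

  This estimate forces the resolvent bound directly.  For \<open>\<bar>\<mu>\<bar> \<ge> 1\<close> and \<open>y = \<mu> x - T x\<close>, expand
  \<open>(\<mu> - 1) \<parallel>x\<parallel>\<^sup>2 = \<langle>y, x\<rangle> - \<langle>x - T x, x\<rangle>\<close>; as \<open>\<parallel>T x\<parallel> \<ge> \<parallel>x\<parallel> - \<parallel>y\<parallel>\<close>, the loss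
  \<open>\<parallel>x\<parallel>\<^sup>2 - \<parallel>T x\<parallel>\<^sup>2\<close> is at most \<open>2 \<parallel>y\<parallel> \<parallel>x\<parallel>\<close>, so
  \<open>\<bar>\<mu> - 1\<bar> \<parallel>x\<parallel> \<le> (1 + 2 M) \<parallel>y\<parallel>\<close> (\<open>resolvent_lower_bound\<close>).  Outside the closed unit disc this is
  the Ritt condition.  On the circle away from \<open>1\<close> the resolvent stays bounded, hence continues
  across it, and only \<open>1\<close> can remain in the spectrum.

  For the fixed space: \<open>T x = x\<close> forces \<open>E = 0\<close> and thus \<open>\<integral>\<^sub>0\<^sup>\<tau> \<parallel>C x\<parallel>\<^sup>2 = 0\<close>.  Conversely, if the latter
  vanishes then \<open>Re \<langle>x - T x, x\<rangle> \<le> E/2\<close>, whereas the energy balance reads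
  \<open>\<parallel>x - T x\<parallel>\<^sup>2 = 2 Re \<langle>x - T x, x\<rangle> - 2 E\<close>; so \<open>x = T x\<close>.  The statement about the point spectrum
  says that the fixed space is trivial.
\<close>

section \<open>Complex Hilbert spaces and adjoints\<close>

lemma scaleC_1: "1 *\<^sub>C (x::'x::complex_hilbert_space) = x"
  using scaleC_of_real[of 1 x] by simp

lemma scaleC_scaleR: "a *\<^sub>C (r *\<^sub>R (x::'x::complex_hilbert_space)) = r *\<^sub>R (a *\<^sub>C x)"
  using scaleC_scaleC[of a "complex_of_real r" x] scaleC_scaleC[of "complex_of_real r" a x]
  by (simp add: scaleC_of_real mult.commute)

lemma scaleC_0_left: "0 *\<^sub>C (x::'x::complex_hilbert_space) = 0"
  using scaleC_of_real[of 0 x] by simp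

lemma scaleC_minus_left: "(- a) *\<^sub>C (x::'x::complex_hilbert_space) = - (a *\<^sub>C x)"
  using scaleC_add_left[of "-a" a x] scaleC_0_left[of x] by (simp add: eq_neg_iff_add_eq_0)

lemma scaleC_diff_left: "(a - b) *\<^sub>C (x::'x::complex_hilbert_space) = a *\<^sub>C x - b *\<^sub>C x"
  using scaleC_add_left[of a "-b" x] by (simp add: scaleC_minus_left)

lemma scaleC_diff_right: "a *\<^sub>C (x - y::'x::complex_hilbert_space) = a *\<^sub>C x - a *\<^sub>C y"
  using scaleC_add_right[of a "x - y" y] by (simp add: eq_diff_eq)

lemma inner_scaleC_right: "inner x (a *\<^sub>C y) = inner (cnj a *\<^sub>C x) (y::'x::complex_hilbert_space)"
  by (simp add: inner_eq_Re_cinner cinner_scaleC_left cinner_commute[of x y]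
      cinner_commute[of x "a *\<^sub>C y"])

lemma norm_scaleC: "norm (a *\<^sub>C (x::'x::complex_hilbert_space)) = cmod a * norm x"
proof -
  have "(norm (a *\<^sub>C x))\<^sup>2 = inner ((cnj a * a) *\<^sub>C x) x"
    by (simp add: power2_norm_eq_inner inner_scaleC_right scaleC_scaleC)
  also have "cnj a * a = complex_of_real ((cmod a)\<^sup>2)"
    by (metis complex_norm_square mult.commute)
  also have "inner (complex_of_real ((cmod a)\<^sup>2) *\<^sub>C x) x = (cmod a * norm x)\<^sup>2"
    by (simp only: scaleC_of_real inner_scaleR_left power2_norm_eq_inner power_mult_distrib)
  finally show ?thesis by (simp add: power2_eq_iff_nonneg)
qed

lemma bounded_linear_scaleC: "bounded_linear ((*\<^sub>C) c :: 'x::complex_hilbert_space \<Rightarrow> 'x)"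
proof (rule bounded_linear_intro)
  show "c *\<^sub>C (x + y :: 'x) = c *\<^sub>C x + c *\<^sub>C y" for x y by (rule scaleC_add_right)
  show "c *\<^sub>C (a *\<^sub>R x :: 'x) = a *\<^sub>R c *\<^sub>C x" for a x
    by (rule scaleC_scaleR)
  show "norm (c *\<^sub>C x :: 'x) \<le> norm x * cmod c" for x by (simp add: norm_scaleC mult.commute)
qed

lemma inner_cadjoint:
  assumes "complex_linear f"
  shows "inner (blinfun_apply f x) y = inner x (blinfun_apply (cadjoint f) y)"
  by (simp add: inner_eq_Re_cinner cinner_cadjoint[OF assms])

lemma cadjoint_scaleC:
  assumes "complex_linear f"
  shows "blinfun_apply (cadjoint f) (c *\<^sub>C y) = c *\<^sub>C blinfun_apply (cadjoint f) y"
proof -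
  have "inner x (blinfun_apply (cadjoint f) (c *\<^sub>C y)) = inner x (c *\<^sub>C blinfun_apply (cadjoint f) y)" for x
    using assms by (simp add: inner_scaleC_right flip: inner_cadjoint[OF assms])
      (simp add: complex_linear_def)
  then show ?thesis by (subst vector_eq_rdot[symmetric]) (simp add: inner_commute)
qed

text \<open>
  This expresses the size of an adjoint through the bilinear composition of two operators.  The
  right-hand side makes sense for operators that are only real-linear and is continuous in \<open>f\<close>
  and \<open>y\<close>; the values of a simple function approximating a complex-linear \<open>B\<close> need not be
  complex-linear themselves.
\<close>

lemma norm_cadjoint_apply:
  assumes "complex_linear f"
  shows "norm (blinfun_apply (cadjoint f) y) = norm (blinfun_inner_left y o\<^sub>L f)"
proof (rule antisym)
  let ?u = "blinfun_apply (cadjoint f) y"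
  let ?h = "blinfun_inner_left y o\<^sub>L f"
  have h: "blinfun_apply ?h v = inner v ?u" for v
    by (simp add: inner_cadjoint[OF assms])
  have "(norm ?u)\<^sup>2 \<le> norm ?h * norm ?u"
    using norm_blinfun[of ?h ?u] by (simp add: h[of ?u] power2_norm_eq_inner del: blinfun_apply_blinfun_compose)
  then show "norm ?u \<le> norm ?h"
    by (cases "?u = 0") (auto simp: power2_eq_square)
  show "norm ?h \<le> norm ?u"
    by (rule norm_blinfun_bound) (simp_all add: inner_cadjoint[OF assms] Cauchy_Schwarz_ineq2 mult.commute)
qed

lemma norm_cadjoint_apply_le:
  assumes "complex_linear f"
  shows "norm (blinfun_apply (cadjoint f) y) \<le> norm f * norm y"
proof -
  have "norm (blinfun_inner_left y) \<le> norm y"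
    by (rule norm_blinfun_bound) (simp_all add: Cauchy_Schwarz_ineq2 mult.commute)
  then show ?thesis
    unfolding norm_cadjoint_apply[OF assms]
    using norm_blinfun_compose[of "blinfun_inner_left y" f]
      mult_right_mono[of "norm (blinfun_inner_left y)" "norm y" "norm f"]
    by (simp add: mult.commute)
qed

section \<open>Ritt operators from an estimate of the defect\<close>

lemma is_resolvent_at_unique:
  assumes "is_resolvent_at \<mu> T R" "is_resolvent_at \<mu> T R'"
  shows "R = R'"
proof (rule blinfun_eqI)
  fix x
  have "blinfun_apply R x = blinfun_apply R (\<mu> *\<^sub>C blinfun_apply R' x - blinfun_apply T (blinfun_apply R' x))"
    using assms(2) by (simp add: is_resolvent_at_def)
  also have "\<dots> = blinfun_apply R' x" using assms(1) by (simp add: is_resolvent_at_def)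
  finally show "blinfun_apply R x = blinfun_apply R' x" .
qed

lemma resolvent_eq:
  assumes "is_resolvent_at \<mu> T R"
  shows "resolvent \<mu> T = R"
  unfolding resolvent_def using assms is_resolvent_at_unique by blast

text \<open>
  A bounded inverse comes from surjectivity together with a lower bound, the latter giving both
  injectivity and the norm estimate.
\<close>

lemma is_resolvent_atI:
  fixes T :: "'x::complex_hilbert_space \<Rightarrow>\<^sub>L 'x"
  assumes surj: "\<And>y. \<exists>x. \<mu> *\<^sub>C x - blinfun_apply T x = y"
    and below: "\<And>x. norm x \<le> K * norm (\<mu> *\<^sub>C x - blinfun_apply T x)"
  shows "\<exists>R. is_resolvent_at \<mu> T R \<and> norm R \<le> \<bar>K\<bar>"
proof -
  define S where "S x = \<mu> *\<^sub>C x - blinfun_apply T x" for x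
  obtain r where r: "\<And>y. S (r y) = y" using surj unfolding S_def by metis
  have S_diff: "S (x - y) = S x - S y" for x y
    by (simp add: S_def scaleC_diff_right blinfun.diff_right)
  have S_scale: "S (c *\<^sub>R x) = c *\<^sub>R S x" for c x
    by (simp add: S_def blinfun.scaleR_right scaleR_diff_right scaleC_scaleR)
  have S_add: "S (x + y) = S x + S y" for x y
    by (simp add: S_def scaleC_add_right blinfun.add_right)
  have inj: "x = y" if "S x = S y" for x y
    using below[of "x - y"] that S_diff[of x y] by (simp add: S_def[symmetric])
  have bl: "bounded_linear r"
  proof (rule bounded_linear_intro)
    show "r (x + y) = r x + r y" for x y by (rule inj) (simp add: r S_add)
    show "r (c *\<^sub>R x) = c *\<^sub>R r x" for c x by (rule inj) (simp add: r S_scale)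
    show "norm (r y) \<le> norm y * K" for y
      using below[of "r y"] r[of y] by (simp add: S_def mult.commute)
  qed
  have r_norm: "norm (r y) \<le> \<bar>K\<bar> * norm y" for y
    using below[of "r y"] r[of y] mult_right_mono[OF abs_ge_self[of K] norm_ge_zero[of y]]
    by (simp add: S_def)
  have "is_resolvent_at \<mu> T (Blinfun r)"
    unfolding is_resolvent_at_def bounded_linear_Blinfun_apply[OF bl]
    using inj r by (auto simp flip: S_def)
  moreover have "norm (Blinfun r) \<le> \<bar>K\<bar>"
    by (rule norm_blinfun_bound) (simp_all add: bounded_linear_Blinfun_apply[OF bl] r_norm)
  ultimately show ?thesis by blast
qed

text \<open>
  The fixed point is the sum of the Neumann series of \<open>F\<close> at \<open>y\<close>; Banach's fixed point theorem
  yields it without summing.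
\<close>

lemma affine_fixed_point_exists:
  fixes F :: "'x::{real_normed_vector, complete_space} \<Rightarrow>\<^sub>L 'x"
  assumes "norm F < 1"
  shows "\<exists>x. x = y + blinfun_apply F x"
proof -
  have "dist (y + blinfun_apply F u) (y + blinfun_apply F v) \<le> norm F * dist u v" for u v
    using norm_blinfun[of F "u - v"] by (simp add: dist_norm blinfun.diff_right)
  then have "\<exists>!x. y + blinfun_apply F x = x"
    using banach_fix_type[of "norm F" "\<lambda>x. y + blinfun_apply F x"] assms by simp
  then show ?thesis by metis
qed

lemma surjective_outside_unit_disc:
  fixes T :: "'x::complex_hilbert_space \<Rightarrow>\<^sub>L 'x"
  assumes T: "norm T \<le> 1" and \<mu>: "1 < cmod \<mu>"
  shows "\<exists>x. \<mu> *\<^sub>C x - blinfun_apply T x = y"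
proof -
  define F where "F = Blinfun ((*\<^sub>C) (inverse \<mu>) :: 'x \<Rightarrow> 'x) o\<^sub>L T"
  have F: "blinfun_apply F x = inverse \<mu> *\<^sub>C blinfun_apply T x" for x
    by (simp add: F_def bounded_linear_Blinfun_apply[OF bounded_linear_scaleC])
  have "norm F \<le> inverse (cmod \<mu>)"
  proof (rule norm_blinfun_bound)
    fix x
    have "norm (blinfun_apply T x) \<le> norm x"
      using norm_blinfun[of T x] mult_right_mono[OF T norm_ge_zero[of x]] by simp
    then show "norm (blinfun_apply F x) \<le> inverse (cmod \<mu>) * norm x"
      by (simp add: F norm_scaleC norm_inverse mult_left_mono)
  qed simp
  also have "\<dots> < 1" using \<mu> by (simp add: inverse_less_1_iff)
  finally obtain x where "x = inverse \<mu> *\<^sub>C y + blinfun_apply F x"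
    using affine_fixed_point_exists by blast
  then have "\<mu> *\<^sub>C x = \<mu> *\<^sub>C (inverse \<mu> *\<^sub>C y + inverse \<mu> *\<^sub>C blinfun_apply T x)"
    by (simp add: F)
  also have "\<dots> = y + blinfun_apply T x"
  proof -
    have "\<mu> * inverse \<mu> = 1" using \<mu> by (intro right_inverse) auto
    then show ?thesis by (simp only: scaleC_add_right scaleC_scaleC scaleC_1)
  qed
  finally show ?thesis by (intro exI[of _ x]) simp
qed

text \<open>
  With \<open>R = R(\<nu>, T)\<close>, the equation \<open>\<mu> x - T x = y\<close> is equivalent to the contractive fixed point
  problem \<open>x = R y + (\<nu> - \<mu>) R x\<close>.
\<close>

lemma surjective_near_resolvent_point:
  fixes T :: "'x::complex_hilbert_space \<Rightarrow>\<^sub>L 'x"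
  assumes R: "is_resolvent_at \<nu> T R" and near: "cmod (\<mu> - \<nu>) * norm R < 1"
  shows "\<exists>x. \<mu> *\<^sub>C x - blinfun_apply T x = y"
proof -
  define F where "F = R o\<^sub>L Blinfun ((*\<^sub>C) (\<nu> - \<mu>) :: 'x \<Rightarrow> 'x)"
  have F: "blinfun_apply F x = blinfun_apply R ((\<nu> - \<mu>) *\<^sub>C x)" for x
    by (simp add: F_def bounded_linear_Blinfun_apply[OF bounded_linear_scaleC])
  have "norm F \<le> cmod (\<mu> - \<nu>) * norm R"
  proof (rule norm_blinfun_bound)
    show "norm (blinfun_apply F x) \<le> cmod (\<mu> - \<nu>) * norm R * norm x" for x
      using norm_blinfun[of R "(\<nu> - \<mu>) *\<^sub>C x"]
      by (simp add: F norm_scaleC norm_minus_commute[of \<nu> \<mu>] algebra_simps)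
  qed simp
  also note near
  finally obtain x where x: "x = blinfun_apply R y + blinfun_apply F x"
    using affine_fixed_point_exists by blast
  define v where "v = y + (\<nu> - \<mu>) *\<^sub>C x"
  have "x = blinfun_apply R v" using x by (simp add: F v_def blinfun.add_right)
  then have "\<nu> *\<^sub>C x - blinfun_apply T x = v" using R by (simp add: is_resolvent_at_def)
  then show ?thesis
    by (intro exI[of _ x]) (simp add: v_def scaleC_diff_left algebra_simps)
qed

text \<open>
  Write \<open>y = \<mu> x - T x\<close>, so that \<open>(\<mu> - 1) x = y - (x - T x)\<close>.  Testing this with \<open>c x\<close>, where \<open>c\<close>
  is the phase of \<open>\<mu> - 1\<close>, leaves the defect \<open>x - T x\<close>, which is controlled by the loss of energy;
  and that loss is small when \<open>y\<close> is, since \<open>\<parallel>T x\<parallel> = \<parallel>\<mu> x - y\<parallel> \<ge> \<parallel>x\<parallel> - \<parallel>y\<parallel>\<close>.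
\<close>

lemma resolvent_lower_bound:
  fixes T :: "'x::complex_hilbert_space \<Rightarrow>\<^sub>L 'x"
  assumes M: "0 \<le> M" and \<mu>: "1 \<le> cmod \<mu>"
    and Tle: "norm T \<le> 1"
    and defect: "\<And>x c. cmod c = 1 \<Longrightarrow> inner (x - blinfun_apply T x) (c *\<^sub>C x)
        \<le> M * ((norm x)\<^sup>2 - (norm (blinfun_apply T x))\<^sup>2)"
  shows "cmod (\<mu> - 1) * norm x \<le> (1 + 2 * M) * norm (\<mu> *\<^sub>C x - blinfun_apply T x)"
proof (cases "x = 0 \<or> \<mu> = 1")
  case False
  define y where "y = \<mu> *\<^sub>C x - blinfun_apply T x"
  define c where "c = (\<mu> - 1) / cmod (\<mu> - 1)"
  have c: "cmod c = 1" "cnj c * (\<mu> - 1) = complex_of_real (cmod (\<mu> - 1))"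
    using False complex_norm_square[of "\<mu> - 1"]
    by (auto simp: c_def norm_divide power2_eq_square field_simps)
  have "cmod (\<mu> - 1) * (norm x)\<^sup>2 = inner ((\<mu> - 1) *\<^sub>C x) (c *\<^sub>C x)"
    by (simp only: inner_scaleC_right scaleC_scaleC c scaleC_of_real inner_scaleR_left
        power2_norm_eq_inner)
  also have "(\<mu> - 1) *\<^sub>C x = y - (x - blinfun_apply T x)"
    by (simp add: y_def scaleC_diff_left scaleC_1)
  also have "inner (y - (x - blinfun_apply T x)) (c *\<^sub>C x)
      = inner y (c *\<^sub>C x) + inner (x - blinfun_apply T x) ((- c) *\<^sub>C x)"
    by (simp add: scaleC_minus_left inner_diff_left)
  also have "\<dots> \<le> norm y * norm x + M * ((norm x)\<^sup>2 - (norm (blinfun_apply T x))\<^sup>2)"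
    using norm_cauchy_schwarz[of y "c *\<^sub>C x"] c(1) defect[of "- c" x] by (simp add: norm_scaleC)
  also have "M * ((norm x)\<^sup>2 - (norm (blinfun_apply T x))\<^sup>2) \<le> M * (2 * norm y * norm x)"
  proof -
    have Tx: "norm (blinfun_apply T x) \<le> norm x"
      using norm_blinfun[of T x] mult_right_mono[OF Tle norm_ge_zero[of x]] by simp
    have "cmod \<mu> * norm x \<le> norm y + norm (blinfun_apply T x)"
      using norm_triangle_ineq[of y "blinfun_apply T x"] by (simp add: y_def norm_scaleC)
    then have "norm x - norm (blinfun_apply T x) \<le> norm y"
      using mult_right_mono[OF \<mu> norm_ge_zero[of x]] by simp
    then have "(norm x - norm (blinfun_apply T x)) * (norm x + norm (blinfun_apply T x))
        \<le> norm y * (2 * norm x)"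
      using Tx by (intro mult_mono) auto
    then have "(norm x)\<^sup>2 - (norm (blinfun_apply T x))\<^sup>2 \<le> 2 * norm y * norm x"
      by (simp add: power2_eq_square algebra_simps)
    then show ?thesis using M by (rule mult_left_mono)
  qed
  finally have "cmod (\<mu> - 1) * norm x * norm x \<le> (1 + 2 * M) * norm y * norm x"
    by (simp add: power2_eq_square algebra_simps)
  then show ?thesis using False by (simp add: y_def)
qed (use M in auto)

text \<open>
  The lower bound holds up to and including the unit circle.  Outside the disc the resolvent exists
  for every contraction; the lower bound keeps it bounded near a point of the circle other than
  \<open>1\<close>, so it extends to that point.
\<close>

lemma ritt_operator_if_loss_controls_defect:
  fixes T :: "'x::complex_hilbert_space \<Rightarrow>\<^sub>L 'x"
  assumes lin: "complex_linear T" and M: "0 \<le> M" and Tle: "norm T \<le> 1"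
    and defect: "\<And>x c. cmod c = 1 \<Longrightarrow> inner (x - blinfun_apply T x) (c *\<^sub>C x)
        \<le> M * ((norm x)\<^sup>2 - (norm (blinfun_apply T x))\<^sup>2)"
  shows "ritt_operator T" and "spectrum T \<inter> sphere 0 1 \<subseteq> {1}"
proof -
  define K where "K = 1 + 2 * M"
  have K: "K > 0" using M by (simp add: K_def)
  have below: "norm x \<le> K / cmod (\<mu> - 1) * norm (\<mu> *\<^sub>C x - blinfun_apply T x)"
    if "1 \<le> cmod \<mu>" "\<mu> \<noteq> 1" for \<mu> x
    using resolvent_lower_bound[OF M that(1) Tle defect, of x] that(2)
    by (simp add: K_def field_simps)
  have ext: "\<exists>R. is_resolvent_at \<mu> T R \<and> norm R \<le> K / cmod (\<mu> - 1)" if "1 < cmod \<mu>" for \<mu>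
  proof -
    have "\<mu> \<noteq> 1" using that by auto
    then show ?thesis
      using is_resolvent_atI[OF surjective_outside_unit_disc[OF Tle that] below] that K by simp
  qed
  have circle: "\<exists>R. is_resolvent_at \<mu> T R" if \<mu>: "cmod \<mu> = 1" "\<mu> \<noteq> 1" for \<mu>
  proof -
    define d where "d = cmod (\<mu> - 1)"
    \<comment> \<open>At distance \<open>h\<close> outside \<open>\<mu>\<close> the resolvent has norm at most \<open>K / (d - h)\<close>,
      and \<open>h\<close> is below the inverse of that.\<close>
    define h where "h = d / (2 * (K + 1))"
    have d: "d > 0" using \<mu> by (simp add: d_def)
    have h: "h > 0" "h * K < d - h"
    proof -
      show "h > 0" using d K by (simp add: h_def)
      have "h * (K + 1) = d / 2" using K by (simp add: h_def field_simps)
      then show "h * K < d - h" using d by (simp add: algebra_simps)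
    qed
    define \<nu> where "\<nu> = complex_of_real (1 + h) * \<mu>"
    have dist: "cmod (\<mu> - \<nu>) = h"
      using h(1) \<mu>(1) by (simp add: \<nu>_def algebra_simps norm_mult)
    have "cmod \<nu> = 1 + h" using h(1) \<mu>(1) unfolding \<nu>_def norm_mult norm_of_real by simp
    then obtain R where R: "is_resolvent_at \<nu> T R" "norm R \<le> K / cmod (\<nu> - 1)"
      using ext[of \<nu>] h(1) by auto
    have far: "d - h \<le> cmod (\<nu> - 1)"
      using norm_triangle_ineq[of "\<mu> - \<nu>" "\<nu> - 1"] dist by (simp add: d_def)
    have pos: "0 < h * K" using h K by simp
    have "h * norm R \<le> h * K / cmod (\<nu> - 1)"
      using mult_left_mono[OF R(2), of h] h(1) by simp
    also have "\<dots> < 1" using far h(2) pos by (simp add: divide_less_eq_1)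
    finally have "cmod (\<mu> - \<nu>) * norm R < 1" by (simp add: dist)
    from is_resolvent_atI[OF surjective_near_resolvent_point[OF R(1) this] below] \<mu>
    show ?thesis by auto
  qed
  have "spectral_radius T \<le> 1"
    unfolding spectral_radius_def
  proof (rule SUP_least)
    fix \<mu> assume "\<mu> \<in> spectrum T"
    then have "cmod \<mu> \<le> 1" using ext[of \<mu>] by (force simp: spectrum_def)
    then show "ennreal (cmod \<mu>) \<le> 1" by (simp add: ennreal_le_1)
  qed
  moreover have "norm (resolvent \<mu> T) \<le> K / cmod (\<mu> - 1)" if "1 < cmod \<mu>" for \<mu>
    using ext[OF that] resolvent_eq by auto
  ultimately show "ritt_operator T" using lin K by (auto simp: ritt_operator_def)
  show "spectrum T \<inter> sphere 0 1 \<subseteq> {1}"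
  proof
    fix \<mu> assume "\<mu> \<in> spectrum T \<inter> sphere 0 1"
    then have "cmod \<mu> = 1" "\<nexists>R. is_resolvent_at \<mu> T R" by (auto simp: spectrum_def)
    then show "\<mu> \<in> {1}" using circle by blast
  qed
qed

section \<open>Measurability of observed trajectories\<close>

text \<open>
  Without separability, Borel measurability of the pair \<open>(B, p)\<close> is not available.  Composition
  is therefore checked on the approximating simple functions, whose finitely many values each give
  a continuous function of \<open>t\<close>; separate continuity of \<open>\<Phi>\<close> is enough for this and for the limit.
\<close>

lemma strongly_measurable_compose_continuous:
  fixes B :: "real \<Rightarrow> 'a::real_normed_vector" and p :: "real \<Rightarrow> 'b::topological_space"
    and \<Phi> :: "'a \<Rightarrow> 'b \<Rightarrow> real"
  assumes B: "strongly_measurable (lebesgue_on S) B" and S: "S \<in> sets lebesgue"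
    and p: "continuous_on S p"
    and \<Phi>1: "\<And>L. continuous_on UNIV (\<Phi> L)" and \<Phi>2: "\<And>z. continuous_on UNIV (\<lambda>L. \<Phi> L z)"
  shows "(\<lambda>t. \<Phi> (B t) (p t)) \<in> borel_measurable (lebesgue_on S)"
proof -
  obtain s where s: "\<And>n. simple_function (lebesgue_on S) (s n)"
    and ae: "AE t in lebesgue_on S. (\<lambda>n. s n t) \<longlonglongrightarrow> B t"
    using B unfolding strongly_measurable_def by blast
  have meas_n: "(\<lambda>t. \<Phi> (s n t) (p t)) \<in> borel_measurable (lebesgue_on S)" for n
  proof -
    have meas: "(\<lambda>t. \<Phi> L (p t)) \<in> borel_measurable (lebesgue_on S)" for L
      by (intro continuous_imp_measurable_on_sets_lebesgue S continuous_on_compose2[OF \<Phi>1 p]) auto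
    have fin: "finite (s n ` S)"
      using simple_functionD(1)[OF s[of n]] by (simp add: space_restrict_space)
    have lev: "(\<lambda>t. indicat_real (s n -` {L} \<inter> S) t) \<in> borel_measurable (lebesgue_on S)" for L
      using simple_functionD(2)[OF s[of n], of "{L}"] by (simp add: space_restrict_space)
    have "(\<lambda>t. \<Sum>L\<in>s n ` S. indicat_real (s n -` {L} \<inter> S) t * \<Phi> L (p t))
        \<in> borel_measurable (lebesgue_on S)"
      by (intro borel_measurable_sum borel_measurable_times meas lev)
    moreover have "(\<Sum>L\<in>s n ` S. indicat_real (s n -` {L} \<inter> S) t * \<Phi> L (p t)) = \<Phi> (s n t) (p t)"
      if "t \<in> S" for t
    proof -
      have "(\<Sum>L\<in>s n ` S. indicat_real (s n -` {L} \<inter> S) t * \<Phi> L (p t))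
          = (\<Sum>L\<in>s n ` S. if L = s n t then \<Phi> L (p t) else 0)"
        using that by (intro sum.cong) (auto simp: indicator_def)
      then show ?thesis using fin that by simp
    qed
    ultimately show ?thesis
      by (subst measurable_cong[where g="\<lambda>t. \<Sum>L\<in>s n ` S. indicat_real (s n -` {L} \<inter> S) t * \<Phi> L (p t)"])
        (simp_all add: space_restrict_space)
  qed
  from ae obtain N where N: "N \<in> null_sets (lebesgue_on S)"
    and conv: "\<And>t. t \<in> S - N \<Longrightarrow> (\<lambda>n. s n t) \<longlonglongrightarrow> B t"
    by (auto elim!: AE_E3 simp: space_restrict_space)
  have negN: "negligible N" "N \<subseteq> S"
    using N S by (auto simp: null_sets_restrict_space negligible_iff_null_sets)
  have N_leb: "N \<in> sets lebesgue" using negN by (simp add: negligible_imp_sets)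
  have good: "(\<lambda>t. \<Phi> (B t) (p t)) \<in> borel_measurable (lebesgue_on (S - N))"
  proof (rule borel_measurable_LIMSEQ_real)
    show "(\<lambda>t. \<Phi> (s n t) (p t)) \<in> borel_measurable (lebesgue_on (S - N))" for n
      by (rule measurable_restrict_mono[OF meas_n]) auto
    fix t assume "t \<in> space (lebesgue_on (S - N))"
    then show "(\<lambda>n. \<Phi> (s n t) (p t)) \<longlonglongrightarrow> \<Phi> (B t) (p t)"
      using continuous_on_tendsto_compose[OF \<Phi>2 conv] by (simp add: space_restrict_space)
  qed
  then have G: "(\<lambda>t. if t \<in> S - N then \<Phi> (B t) (p t) else 0) \<in> borel_measurable lebesgue"
    (is "?G \<in> _") using S N_leb by (intro borel_measurable_if_I good) auto
  \<comment> \<open>The null set is filled in by completeness of the Lebesgue measure.\<close>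
  have "(\<lambda>t. if t \<in> S then \<Phi> (B t) (p t) else 0) \<in> borel_measurable lebesgue"
    (is "?F \<in> _")
    unfolding borel_measurable_iff_le
  proof
    fix a
    have "{t. ?G t \<le> a} \<in> sets lebesgue" using G by (simp add: borel_measurable_iff_le)
    moreover have "{t. ?F t \<le> a} \<inter> N \<in> sets lebesgue"
      using negN by (intro negligible_imp_sets) (auto intro: negligible_subset)
    ultimately have "({t. ?G t \<le> a} - N) \<union> ({t. ?F t \<le> a} \<inter> N) \<in> sets lebesgue"
      using N_leb by (intro sets.Un sets.Diff)
    moreover have "{t \<in> space lebesgue. ?F t \<le> a} = ({t. ?G t \<le> a} - N) \<union> ({t. ?F t \<le> a} \<inter> N)"
      by auto
    ultimately show "{t \<in> space lebesgue. ?F t \<le> a} \<in> sets lebesgue" by simp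
  qed
  then show ?thesis using S by (simp add: borel_measurable_if_D)
qed

lemma cadjoint_square_integrable:
  fixes B :: "real \<Rightarrow> 'v::complex_hilbert_space \<Rightarrow>\<^sub>L 'x::complex_hilbert_space"
  assumes B: "L2_loc B" and a: "0 \<le> a" and p: "continuous_on {0..a} p"
  shows "(\<lambda>s. (norm (blinfun_apply (cadjoint (B s)) (p s)))\<^sup>2) integrable_on {0..a}"
proof -
  let ?\<Phi> = "\<lambda>(L :: 'v \<Rightarrow>\<^sub>L 'x) z. norm (blinfun_inner_left z o\<^sub>L L)"
  have lin: "complex_linear (B s)" if "s \<in> {0..a}" for s using B that by (auto simp: L2_loc_def)
  \<comment> \<open>\<open>B\<close> is approximated on the whole half-line, so \<open>p\<close> is extended there by its value at \<open>a\<close>.\<close>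
  have "(\<lambda>t. ?\<Phi> (B t) (p (min t a))) \<in> borel_measurable (lebesgue_on {0..})"
  proof (rule strongly_measurable_compose_continuous[where \<Phi>="?\<Phi>" and p="\<lambda>t. p (min t a)"])
    show "strongly_measurable (lebesgue_on {0..}) B" using B by (simp add: L2_loc_def)
    show "{0::real..} \<in> sets lebesgue" by simp
    show "continuous_on {0..} (\<lambda>t. p (min t a))"
      using a by (intro continuous_on_compose2[OF p] continuous_intros) auto
    show "continuous_on UNIV (?\<Phi> L)" for L
      by (intro continuous_on_norm bounded_linear.continuous_on
          [OF bounded_bilinear.bounded_linear_left[OF bounded_bilinear_blinfun_compose]]
          bounded_linear.continuous_on[OF bounded_linear_blinfun_inner_left] continuous_on_id)
    show "continuous_on UNIV (\<lambda>L. ?\<Phi> L z)" for z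
      by (intro continuous_on_norm bounded_linear.continuous_on
          [OF bounded_bilinear.bounded_linear_right[OF bounded_bilinear_blinfun_compose]]
          continuous_on_id)
  qed
  then have "(\<lambda>t. ?\<Phi> (B t) (p (min t a))) \<in> borel_measurable (lebesgue_on {0..a})"
    by (rule measurable_restrict_mono) auto
  then have meas: "(\<lambda>s. norm (blinfun_apply (cadjoint (B s)) (p s))) \<in> borel_measurable (lebesgue_on {0..a})"
    by (subst measurable_cong) (simp_all add: space_restrict_space norm_cadjoint_apply lin)
  have "compact (p ` {0..a})" using p by (intro compact_continuous_image) auto
  then obtain W where W: "W > 0" "\<And>r. r \<in> {0..a} \<Longrightarrow> norm (p r) \<le> W"
    using compact_imp_bounded bounded_pos by (metis imageI)
  show ?thesis
  proof (rule measurable_bounded_by_integrable_imp_integrable)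
    show "(\<lambda>s. (norm (blinfun_apply (cadjoint (B s)) (p s)))\<^sup>2) \<in> borel_measurable (lebesgue_on {0..a})"
      using meas by (rule borel_measurable_power)
    show "(\<lambda>s. W\<^sup>2 * (norm (B s))\<^sup>2) integrable_on {0..a}"
      using B a by (intro integrable_on_mult_right)
        (auto simp: L2_loc_def intro: set_lebesgue_integral_eq_integral(1))
    fix s assume s: "s \<in> {0..a}"
    have "norm (blinfun_apply (cadjoint (B s)) (p s)) \<le> norm (B s) * W"
      using norm_cadjoint_apply_le[OF lin[OF s], of "p s"] mult_left_mono[OF W(2)[OF s], of "norm (B s)"] by simp
    then show "norm ((norm (blinfun_apply (cadjoint (B s)) (p s)))\<^sup>2) \<le> W\<^sup>2 * (norm (B s))\<^sup>2"
      using power_mono[of "norm (blinfun_apply (cadjoint (B s)) (p s))" "norm (B s) * W" 2]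
      by (simp add: power_mult_distrib mult.commute)
  qed simp
qed

section \<open>Energy estimates for the damped equation\<close>

text \<open>
  A substitute for differentiating an absolutely continuous function: summing over a fine equidistant
  partition bounds the total increment of \<open>\<phi>\<close> by \<open>\<epsilon> (G(\<tau>) - G(0))\<close> for every \<open>\<epsilon>\<close>.
\<close>

lemma eq_if_small_increments:
  fixes \<phi> G :: "real \<Rightarrow> real"
  assumes "0 \<le> \<tau>"
    and small: "\<And>\<epsilon>. \<epsilon> > 0 \<Longrightarrow> \<exists>\<delta>>0. \<forall>s t. 0 \<le> s \<and> s \<le> t \<and> t \<le> \<tau> \<and> t - s < \<delta> \<longrightarrow>
                  \<bar>\<phi> t - \<phi> s\<bar> \<le> \<epsilon> * (G t - G s)"
  shows "\<phi> \<tau> = \<phi> 0"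
proof -
  have le: "\<bar>\<phi> \<tau> - \<phi> 0\<bar> \<le> \<epsilon> * (G \<tau> - G 0)" if "\<epsilon> > 0" for \<epsilon>
  proof -
    obtain \<delta> where \<delta>: "\<delta> > 0" and d: "\<And>s t. 0 \<le> s \<Longrightarrow> s \<le> t \<Longrightarrow> t \<le> \<tau> \<Longrightarrow> t - s < \<delta> \<Longrightarrow>
        \<bar>\<phi> t - \<phi> s\<bar> \<le> \<epsilon> * (G t - G s)"
      using small[OF \<open>\<epsilon> > 0\<close>] by blast
    obtain n :: nat where n: "\<tau> / \<delta> < real n" using reals_Archimedean2 by blast
    have n0: "n > 0" using n \<delta> \<open>0 \<le> \<tau>\<close> by (cases n) (auto simp: field_simps)
    define h where "h = \<tau> / n"
    have h: "0 \<le> h" "h < \<delta>" "n * h = \<tau>"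
      using n n0 \<delta> \<open>0 \<le> \<tau>\<close> by (auto simp: h_def field_simps)
    have "k \<le> n \<Longrightarrow> \<bar>\<phi> (k * h) - \<phi> 0\<bar> \<le> \<epsilon> * (G (k * h) - G 0)" for k :: nat
    proof (induction k)
      case (Suc k)
      have "real (Suc k) * h \<le> real n * h"
        using Suc.prems h(1) by (intro mult_right_mono) auto
      then have "\<bar>\<phi> (Suc k * h) - \<phi> (k * h)\<bar> \<le> \<epsilon> * (G (Suc k * h) - G (k * h))"
        using h by (intro d) (auto simp: algebra_simps)
      then show ?case using Suc by (simp add: algebra_simps)
    qed simp
    from this[of n] h show ?thesis by simp
  qed
  show ?thesis
  proof (rule ccontr)
    assume ne: "\<phi> \<tau> \<noteq> \<phi> 0"
    define d where "d = \<bar>\<phi> \<tau> - \<phi> 0\<bar>"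
    define g where "g = \<bar>G \<tau> - G 0\<bar> + 1"
    have dg: "d > 0" "g > 0" "G \<tau> - G 0 \<le> g" using ne by (auto simp: d_def g_def)
    have "d \<le> d / (2 * g) * (G \<tau> - G 0)"
      using le[of "d / (2 * g)"] dg by (simp add: d_def)
    also have "\<dots> \<le> d / (2 * g) * g" using dg by (intro mult_left_mono) auto
    finally show False using dg by simp
  qed
qed

lemma integral_linear_combination:
  fixes f g :: "real \<Rightarrow> real"
  assumes "f integrable_on S" "g integrable_on S"
  shows "integral S (\<lambda>s. \<alpha> * f s + \<beta> * g s) = \<alpha> * integral S f + \<beta> * integral S g"
  by (intro integral_unique has_integral_add has_integral_mult_right integrable_integral assms)

text \<open>
  The equation \<open>w(t) = w(0) - \<integral>\<^sub>0\<^sup>t C(s)\<^sup>* C(s) w(s) ds\<close>, tested against vectors \<open>y\<close>.  In the weak form only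
  integrals of real functions occur, so that no integration theory in a possibly nonseparable
  Hilbert space is needed.
\<close>

locale damped_trajectory =
  fixes \<tau> :: real
    and C :: "real \<Rightarrow> 'x::real_inner \<Rightarrow> 'v::real_inner"
    and b :: "real \<Rightarrow> real"
    and w :: "real \<Rightarrow> 'x"
  assumes \<tau>_nonneg: "0 \<le> \<tau>"
    and linear_C: "\<And>s. s \<in> {0..\<tau>} \<Longrightarrow> linear (C s)"
    and norm_C_le: "\<And>s y. s \<in> {0..\<tau>} \<Longrightarrow> norm (C s y) \<le> b s * norm y"
    and b_square_integrable: "(\<lambda>s. (b s)\<^sup>2) integrable_on {0..\<tau>}"
    and C_square_integrable:
      "\<And>p. continuous_on {0..\<tau>} p \<Longrightarrow> (\<lambda>s. (norm (C s (p s)))\<^sup>2) integrable_on {0..\<tau>}"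
    and continuous_w: "continuous_on {0..\<tau>} w"
    and weak_equation: "\<And>t y. t \<in> {0..\<tau>} \<Longrightarrow>
      ((\<lambda>s. inner (C s (w s)) (C s y)) has_integral inner (w 0 - w t) y) {0..t}"
begin

definition dissipation :: real where
  "dissipation = integral {0..\<tau>} (\<lambda>s. (norm (C s (w s)))\<^sup>2)"

text \<open>
  The summand \<open>1\<close> makes it safe to divide by this bound on the squared \<open>L\<^sup>2\<close> norm of \<open>b\<close>.
\<close>

definition gain :: real where
  "gain = 1 + integral {0..\<tau>} (\<lambda>s. (b s)\<^sup>2)"

lemma gain_ge_1: "gain \<ge> 1"
  unfolding gain_def by (simp add: Henstock_Kurzweil_Integration.integral_nonneg[OF b_square_integrable])

lemma C_w_square_integrable: "(\<lambda>s. (norm (C s (w s)))\<^sup>2) integrable_on {0..\<tau>}"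
  by (rule C_square_integrable[OF continuous_w])

lemma dissipation_nonneg: "dissipation \<ge> 0"
  unfolding dissipation_def
  by (simp add: Henstock_Kurzweil_Integration.integral_nonneg[OF C_w_square_integrable])

lemma weak_equation_between:
  assumes "0 \<le> s" "s \<le> t" "t \<le> \<tau>"
  shows "((\<lambda>r. inner (C r (w r)) (C r y)) has_integral inner (w s - w t) y) {s..t}"
proof -
  let ?f = "\<lambda>r. inner (C r (w r)) (C r y)"
  have t: "(?f has_integral inner (w 0 - w t) y) {0..t}"
    and s: "(?f has_integral inner (w 0 - w s) y) {0..s}"
    using weak_equation assms by auto
  have int: "?f integrable_on {0..t}" using t by blast
  have "integral {0..s} ?f + integral {s..t} ?f = integral {0..t} ?f"
    using assms int by (intro Henstock_Kurzweil_Integration.integral_combine) auto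
  then have "integral {s..t} ?f = inner (w s - w t) y"
    using s t by (simp add: integral_unique inner_diff_left)
  moreover have "?f integrable_on {s..t}"
    using integrable_subinterval_real[OF int] assms by simp
  ultimately show ?thesis by (metis integrable_integral)
qed

text \<open>
  Formally \<open>d/dt \<parallel>w\<parallel>\<^sup>2 = - 2 \<parallel>C w\<parallel>\<^sup>2\<close>.  On a short interval \<open>[s,t]\<close>,
  \<open>\<parallel>w(s)\<parallel>\<^sup>2 - \<parallel>w(t)\<parallel>\<^sup>2\<close> is the inner product of \<open>w(s) - w(t)\<close> with \<open>w(s) + w(t)\<close>, to which the weak equation
  applies with \<open>y = w(s) + w(t)\<close>.  Replacing \<open>y\<close> by \<open>2 w(r)\<close> under the integral costs at most
  the oscillation of \<open>w\<close> times the integral of \<open>b\<^sup>2\<close> over \<open>[s,t]\<close>, up to a constant.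
\<close>

lemma energy_identity: "(norm (w 0))\<^sup>2 - (norm (w \<tau>))\<^sup>2 = 2 * dissipation"
proof -
  define e where "e r = (norm (C r (w r)))\<^sup>2" for r
  define \<phi> where "\<phi> t = (norm (w t))\<^sup>2 + 2 * integral {0..t} e" for t
  define G where "G t = integral {0..t} (\<lambda>s. (b s)\<^sup>2)" for t
  have e_int: "e integrable_on {s..t}" and b_int: "(\<lambda>s. (b s)\<^sup>2) integrable_on {s..t}"
    if "0 \<le> s" "t \<le> \<tau>" for s t
    using that integrable_subinterval_real[OF C_w_square_integrable]
      integrable_subinterval_real[OF b_square_integrable] by (auto simp: e_def[abs_def])
  have "compact (w ` {0..\<tau>})" using continuous_w by (intro compact_continuous_image) auto
  then obtain W where W: "W > 0" "\<And>r. r \<in> {0..\<tau>} \<Longrightarrow> norm (w r) \<le> W"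
    using compact_imp_bounded bounded_pos by (metis imageI)
  have "\<phi> \<tau> = \<phi> 0"
  proof (rule eq_if_small_increments[OF \<tau>_nonneg])
    fix \<epsilon> :: real assume "\<epsilon> > 0"
    define \<eta> where "\<eta> = \<epsilon> / (2 * W)"
    have \<eta>: "\<eta> > 0" "2 * W * \<eta> = \<epsilon>" using \<open>\<epsilon> > 0\<close> W(1) by (auto simp: \<eta>_def)
    have "uniformly_continuous_on {0..\<tau>} w"
      using continuous_w by (intro compact_uniformly_continuous) auto
    then obtain \<delta> where \<delta>: "\<delta> > 0"
      "\<And>r s. r \<in> {0..\<tau>} \<Longrightarrow> s \<in> {0..\<tau>} \<Longrightarrow> dist s r < \<delta> \<Longrightarrow> dist (w s) (w r) < \<eta>"
      using \<eta>(1) unfolding uniformly_continuous_on_def by metis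
    have "\<bar>\<phi> t - \<phi> s\<bar> \<le> \<epsilon> * (G t - G s)" if st: "0 \<le> s" "s \<le> t" "t \<le> \<tau>" "t - s < \<delta>" for s t
    proof -
      let ?p = "w s + w t"
      let ?h = "\<lambda>r. inner (C r (w r)) (C r (w r + w r - ?p))"
      have eq: "2 * e r - inner (C r (w r)) (C r ?p) = ?h r" if "r \<in> {s..t}" for r
        using that st
        by (simp add: e_def power2_norm_eq_inner linear_diff[OF linear_C] linear_add[OF linear_C]
            inner_diff_right inner_add_right)
      have "((\<lambda>r. 2 * e r - inner (C r (w r)) (C r ?p)) has_integral
          2 * integral {s..t} e - inner (w s - w t) ?p) {s..t}"
        using e_int st
        by (intro has_integral_diff has_integral_mult_right weak_equation_between)
          (auto intro: integrable_integral)
      then have h: "(?h has_integral 2 * integral {s..t} e - inner (w s - w t) ?p) {s..t}"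
        by (rule has_integral_eq[rotated]) (rule eq)
      have "\<phi> t - \<phi> s = 2 * integral {s..t} e - inner (w s - w t) ?p"
        using Henstock_Kurzweil_Integration.integral_combine[of 0 s t e] e_int[of 0 t] st
        by (simp add: \<phi>_def power2_norm_eq_inner inner_diff_left inner_diff_right inner_add_right inner_commute)
      also have "\<dots> = integral {s..t} ?h" using h by (simp add: integral_unique)
      finally have inc: "\<phi> t - \<phi> s = integral {s..t} ?h" .
      have "norm (integral {s..t} ?h) \<le> integral {s..t} (\<lambda>r. \<epsilon> * (b r)\<^sup>2)"
      proof (rule Henstock_Kurzweil_Integration.integral_norm_bound_integral)
        show "?h integrable_on {s..t}" using h by blast
        show "(\<lambda>r. \<epsilon> * (b r)\<^sup>2) integrable_on {s..t}"
          using b_int st by (intro integrable_on_mult_right) auto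
        fix r assume r: "r \<in> {s..t}"
        have "norm (w r - w s) \<le> \<eta>" "norm (w r - w t) \<le> \<eta>"
          using \<delta>(2)[of s r] \<delta>(2)[of t r] r st by (auto simp: dist_norm)
        then have near: "norm (w r + w r - ?p) \<le> 2 * \<eta>"
          using norm_triangle_ineq[of "w r - w s" "w r - w t"] by (simp add: algebra_simps)
        have r': "r \<in> {0..\<tau>}" using r st by auto
        have "0 \<le> b r * norm (w r)" "0 \<le> b r * norm (w r + w r - ?p)"
          using norm_C_le[OF r'] norm_ge_zero order_trans by blast+
        have "norm (?h r) \<le> norm (C r (w r)) * norm (C r (w r + w r - ?p))"
          by (simp add: Cauchy_Schwarz_ineq2)
        also have "\<dots> \<le> (b r * norm (w r)) * (b r * norm (w r + w r - ?p))"
          by (intro mult_mono norm_C_le r') (use \<open>0 \<le> b r * norm (w r)\<close> in auto)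
        also have "\<dots> = (b r)\<^sup>2 * (norm (w r) * norm (w r + w r - ?p))"
          by (simp add: power2_eq_square)
        also have "\<dots> \<le> (b r)\<^sup>2 * (W * (2 * \<eta>))"
          using near W r' by (intro mult_left_mono mult_mono) auto
        also have "\<dots> = \<epsilon> * (b r)\<^sup>2" using \<eta>(2) by (simp add: algebra_simps)
        finally show "norm (?h r) \<le> \<epsilon> * (b r)\<^sup>2" .
      qed
      also have "\<dots> = \<epsilon> * (G t - G s)"
        using Henstock_Kurzweil_Integration.integral_combine[of 0 s t "\<lambda>r. (b r)\<^sup>2"] b_int[of 0 t] st
        by (simp add: G_def)
      finally show ?thesis by (simp add: inc)
    qed
    then show "\<exists>\<delta>>0. \<forall>s t. 0 \<le> s \<and> s \<le> t \<and> t \<le> \<tau> \<and> t - s < \<delta> \<longrightarrow>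
        \<bar>\<phi> t - \<phi> s\<bar> \<le> \<epsilon> * (G t - G s)"
      using \<delta>(1) by blast
  qed
  then show ?thesis by (simp add: \<phi>_def dissipation_def e_def[abs_def])
qed

text \<open>
  Testing with \<open>y = w(0) - w(t)\<close> gives \<open>\<parallel>y\<parallel>\<^sup>2 \<le> \<integral>\<^sub>0\<^sup>t \<parallel>C w\<parallel> b \<parallel>y\<parallel>\<close>.  The arithmetic-geometric mean
  inequality, weighted by \<open>gain\<close>, splits the integrand so that the part containing \<open>y\<close>
  contributes at most \<open>\<parallel>y\<parallel>\<^sup>2 / 2\<close>, which is absorbed on the left.
\<close>

lemma displacement_le:
  assumes t: "t \<in> {0..\<tau>}"
  shows "(norm (w 0 - w t))\<^sup>2 \<le> gain * dissipation"
proof -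
  define y where "y = w 0 - w t"
  let ?g = "\<lambda>s. gain / 2 * (norm (C s (w s)))\<^sup>2 + (norm y)\<^sup>2 / (2 * gain) * (b s)\<^sup>2"
  have k: "gain > 0" using gain_ge_1 by simp
  have g_int: "?g integrable_on {0..\<tau>}"
    by (intro integrable_add integrable_on_mult_right C_w_square_integrable b_square_integrable)
  have "(norm y)\<^sup>2 = integral {0..t} (\<lambda>s. inner (C s (w s)) (C s y))"
    using weak_equation[OF t, of y] by (simp add: y_def integral_unique power2_norm_eq_inner)
  also have "\<dots> \<le> integral {0..t} ?g"
  proof (rule integral_le)
    show "(\<lambda>s. inner (C s (w s)) (C s y)) integrable_on {0..t}" using weak_equation[OF t] by blast
    show "?g integrable_on {0..t}" using integrable_subinterval_real[OF g_int] t by auto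
    fix s assume "s \<in> {0..t}"
    then have s: "s \<in> {0..\<tau>}" using t by auto
    have amgm: "p * q \<le> gain / 2 * p\<^sup>2 + q\<^sup>2 / (2 * gain)" for p q :: real
    proof -
      have "0 \<le> (gain * p - q)\<^sup>2 / (2 * gain)" using k by simp
      also have "\<dots> = gain / 2 * p\<^sup>2 + q\<^sup>2 / (2 * gain) - p * q"
        using k by (simp add: power2_eq_square field_simps)
      finally show ?thesis by simp
    qed
    have "inner (C s (w s)) (C s y) \<le> norm (C s (w s)) * (b s * norm y)"
      using norm_cauchy_schwarz norm_C_le[OF s] by (meson mult_left_mono norm_ge_zero order_trans)
    also have "\<dots> \<le> gain / 2 * (norm (C s (w s)))\<^sup>2 + (b s * norm y)\<^sup>2 / (2 * gain)"
      by (rule amgm)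
    finally show "inner (C s (w s)) (C s y) \<le> ?g s" by (simp add: power_mult_distrib mult.commute)
  qed
  also have "\<dots> \<le> integral {0..\<tau>} ?g"
    using t g_int k
    by (intro integral_subset_le integrable_subinterval_real[OF g_int]) auto
  also have "\<dots> = gain / 2 * dissipation + (norm y)\<^sup>2 / (2 * gain) * (gain - 1)"
    by (simp only: integral_linear_combination[OF C_w_square_integrable b_square_integrable])
      (simp add: dissipation_def gain_def)
  also have "\<dots> \<le> gain / 2 * dissipation + (norm y)\<^sup>2 / 2"
    using k by (simp add: field_simps)
  finally show ?thesis by (simp add: y_def)
qed

text \<open>
  Split \<open>C(s) w(0) = C(s) w(s) + C(s) (w(0) - w(s))\<close> and bound the second part by the displacement.
\<close>

lemma observation_le:
  "integral {0..\<tau>} (\<lambda>s. (norm (C s (w 0)))\<^sup>2) \<le> (2 + 2 * gain\<^sup>2) * dissipation"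
proof -
  let ?g = "\<lambda>s. 2 * (norm (C s (w s)))\<^sup>2 + 2 * (gain * dissipation) * (b s)\<^sup>2"
  have "integral {0..\<tau>} (\<lambda>s. (norm (C s (w 0)))\<^sup>2) \<le> integral {0..\<tau>} ?g"
  proof (rule integral_le)
    show "(\<lambda>s. (norm (C s (w 0)))\<^sup>2) integrable_on {0..\<tau>}"
      by (rule C_square_integrable) (rule continuous_on_const)
    show "?g integrable_on {0..\<tau>}"
      by (intro integrable_add integrable_on_mult_right C_w_square_integrable b_square_integrable)
    fix s assume s: "s \<in> {0..\<tau>}"
    have "C s (w 0) = C s (w s) + C s (w 0 - w s)" by (simp add: linear_diff[OF linear_C[OF s]])
    then have "norm (C s (w 0)) \<le> norm (C s (w s)) + norm (C s (w 0 - w s))"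
      by (metis norm_triangle_ineq)
    then have "(norm (C s (w 0)))\<^sup>2 \<le> (norm (C s (w s)) + norm (C s (w 0 - w s)))\<^sup>2"
      by (intro power_mono) auto
    also have "\<dots> \<le> 2 * (norm (C s (w s)))\<^sup>2 + 2 * (norm (C s (w 0 - w s)))\<^sup>2"
      using sum_squares_bound[of "norm (C s (w s))" "norm (C s (w 0 - w s))"]
      by (simp add: power2_sum)
    also have "(norm (C s (w 0 - w s)))\<^sup>2 \<le> (b s * norm (w 0 - w s))\<^sup>2"
      by (intro power_mono norm_C_le s) auto
    also have "\<dots> \<le> (b s)\<^sup>2 * (gain * dissipation)"
      using displacement_le[OF s] by (simp add: power_mult_distrib mult_left_mono)
    finally show "(norm (C s (w 0)))\<^sup>2 \<le> ?g s" by (simp add: algebra_simps)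
  qed
  also have "\<dots> = 2 * dissipation + 2 * (gain * dissipation) * (gain - 1)"
    by (simp only: integral_linear_combination[OF C_w_square_integrable b_square_integrable])
      (simp add: dissipation_def gain_def)
  also have "\<dots> \<le> (2 + 2 * gain\<^sup>2) * dissipation"
    using gain_ge_1 dissipation_nonneg by (simp add: algebra_simps power2_eq_square)
  finally show ?thesis .
qed

text \<open>
  Only the norm of \<open>C(s) y\<close> enters the estimate.  Hence it applies to all
  unimodular multiples \<open>y\<close> of \<open>w(0)\<close> when \<open>C(s)\<close> is complex-linear, and so controls the modulus
  of the complex inner product of the defect with \<open>w(0)\<close>.
\<close>

lemma defect_le:
  assumes y: "\<And>s. s \<in> {0..\<tau>} \<Longrightarrow> norm (C s y) = norm (C s (w 0))"
  shows "inner (w 0 - w \<tau>) y \<le>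
    dissipation / 2 + integral {0..\<tau>} (\<lambda>s. (norm (C s (w 0)))\<^sup>2) / 2"
proof -
  let ?g = "\<lambda>s. (1/2) * (norm (C s (w s)))\<^sup>2 + (1/2) * (norm (C s (w 0)))\<^sup>2"
  have x_int: "(\<lambda>s. (norm (C s (w 0)))\<^sup>2) integrable_on {0..\<tau>}"
    by (rule C_square_integrable) (rule continuous_on_const)
  have weak: "((\<lambda>s. inner (C s (w s)) (C s y)) has_integral inner (w 0 - w \<tau>) y) {0..\<tau>}"
    using weak_equation \<tau>_nonneg by auto
  then have "inner (w 0 - w \<tau>) y = integral {0..\<tau>} (\<lambda>s. inner (C s (w s)) (C s y))"
    by (simp add: integral_unique)
  also have "\<dots> \<le> integral {0..\<tau>} ?g"
  proof (rule integral_le)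
    show "(\<lambda>s. inner (C s (w s)) (C s y)) integrable_on {0..\<tau>}" using weak by blast
    show "?g integrable_on {0..\<tau>}"
      by (intro integrable_add integrable_on_mult_right C_w_square_integrable x_int)
    fix s assume "s \<in> {0..\<tau>}"
    then show "inner (C s (w s)) (C s y) \<le> ?g s"
      using norm_cauchy_schwarz[of "C s (w s)" "C s y"]
        sum_squares_bound[of "norm (C s (w s))" "norm (C s (w 0))"] y[of s] by simp
  qed
  also have "\<dots> = dissipation / 2 + integral {0..\<tau>} (\<lambda>s. (norm (C s (w 0)))\<^sup>2) / 2"
    by (simp only: integral_linear_combination[OF C_w_square_integrable x_int])
      (simp add: dissipation_def)
  finally show ?thesis .
qed

lemma loss_controls_defect:
  assumes "\<And>s. s \<in> {0..\<tau>} \<Longrightarrow> norm (C s y) = norm (C s (w 0))"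
  shows "inner (w 0 - w \<tau>) y \<le> (1 + gain\<^sup>2) * ((norm (w 0))\<^sup>2 - (norm (w \<tau>))\<^sup>2)"
proof -
  have "inner (w 0 - w \<tau>) y \<le>
      dissipation / 2 + integral {0..\<tau>} (\<lambda>s. (norm (C s (w 0)))\<^sup>2) / 2"
    using assms by (rule defect_le)
  also have "\<dots> \<le> (2 + 2 * gain\<^sup>2) * dissipation"
  proof -
    have "p / 2 + q / 2 \<le> r" if "q \<le> r" "p \<le> r" for p q r :: real using that by simp
    moreover have "dissipation \<le> (2 + 2 * gain\<^sup>2) * dissipation"
      using mult_right_mono[of 1 "2 + 2 * gain\<^sup>2" dissipation] dissipation_nonneg by simp
    ultimately show ?thesis using observation_le by blast
  qed
  finally show ?thesis by (simp add: energy_identity algebra_simps)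
qed

text \<open>
  If \<open>w(0)\<close> is unobserved, the inner product of the defect \<open>w(0) - w(\<tau>)\<close> with \<open>w(0)\<close> is at most
  half the dissipation, while the energy identity makes the squared norm of the defect twice that
  product minus twice the dissipation.
\<close>

lemma returns_iff_unobserved:
  "w \<tau> = w 0 \<longleftrightarrow> integral {0..\<tau>} (\<lambda>s. (norm (C s (w 0)))\<^sup>2) = 0"
proof
  assume "w \<tau> = w 0"
  then have "dissipation = 0" using energy_identity by simp
  moreover have "0 \<le> integral {0..\<tau>} (\<lambda>s. (norm (C s (w 0)))\<^sup>2)"
    by (intro Henstock_Kurzweil_Integration.integral_nonneg C_square_integrable continuous_on_const)
      simp
  ultimately show "integral {0..\<tau>} (\<lambda>s. (norm (C s (w 0)))\<^sup>2) = 0"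
    using observation_le by simp
next
  assume "integral {0..\<tau>} (\<lambda>s. (norm (C s (w 0)))\<^sup>2) = 0"
  then have "inner (w 0 - w \<tau>) (w 0) \<le> dissipation / 2" using defect_le[of "w 0"] by simp
  moreover have "(norm (w 0 - w \<tau>))\<^sup>2 = 2 * inner (w 0 - w \<tau>) (w 0) - 2 * dissipation"
    using energy_identity
    by (simp add: power2_norm_eq_inner inner_diff_left inner_diff_right inner_commute)
  ultimately have "(norm (w 0 - w \<tau>))\<^sup>2 \<le> 0" using dissipation_nonneg by simp
  then show "w \<tau> = w 0" by simp
qed

end

section \<open>The monodromy operator\<close>

lemma inner_unitary:
  assumes "unitary_operator u"
  shows "inner (blinfun_apply u x) (blinfun_apply u y) = inner x y"
proof -
  have "blinfun_apply (cadjoint u) (blinfun_apply u y) = y"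
    using assms by (metis unitary_operator_def blinfun_apply_blinfun_compose blinfun_apply_id_blinfun id_apply)
  then show ?thesis using assms by (simp add: unitary_operator_def inner_cadjoint)
qed

lemma unitary_group_inverse:
  assumes "unitary_group T0"
  shows "blinfun_apply (T0 t) (blinfun_apply (T0 (- t)) x) = x"
proof -
  have "T0 t o\<^sub>L T0 (- t) = id_blinfun"
    using assms unfolding unitary_group_def by (metis add.right_inverse)
  then show ?thesis by (metis blinfun_apply_blinfun_compose blinfun_apply_id_blinfun id_apply)
qed

lemma norm_unitary_group:
  assumes "unitary_group T0"
  shows "norm (blinfun_apply (T0 t) x) = norm x"
  using assms by (simp add: norm_eq_sqrt_inner inner_unitary unitary_group_def)

text \<open>
  Strong continuity extends to moving vectors because the operators are isometries.
\<close>

lemma continuous_on_unitary_group: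
  assumes T0: "unitary_group T0" and f: "continuous_on S f" and p: "continuous_on S p"
  shows "continuous_on S (\<lambda>s. blinfun_apply (T0 (f s)) (p s))"
  unfolding continuous_on_def
proof
  fix a assume a: "a \<in> S"
  let ?q = "\<lambda>s. blinfun_apply (T0 (f s)) (p a)"
  have "continuous_on UNIV (\<lambda>t. blinfun_apply (T0 t) (p a))"
    using T0 by (simp add: unitary_group_def)
  then have "continuous_on S ?q" by (rule continuous_on_compose2[OF _ f]) simp
  then have q: "(?q \<longlongrightarrow> ?q a) (at a within S)" using a by (simp add: continuous_on_def)
  have "((\<lambda>s. p s - p a) \<longlongrightarrow> 0) (at a within S)"
    using p a by (simp add: continuous_on_def LIM_zero)
  then have "((\<lambda>s. blinfun_apply (T0 (f s)) (p s - p a)) \<longlongrightarrow> 0) (at a within S)"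
    by (rule Lim_null_comparison[rotated, OF tendsto_norm_zero])
      (simp add: norm_unitary_group[OF T0])
  from tendsto_add[OF this q]
  show "((\<lambda>s. blinfun_apply (T0 (f s)) (p s)) \<longlongrightarrow> blinfun_apply (T0 (f a)) (p a)) (at a within S)"
    by (simp add: blinfun.diff_right)
qed

text \<open>
  Moving \<open>T\<^sub>0(t)\<close> to the other side of the variation of parameters formula turns the integrand
  \<open>T\<^sub>0(t - s) B B\<^sup>* U(s,0) x\<close> into \<open>T\<^sub>0(-s) B B\<^sup>* T\<^sub>0(s) w(s)\<close>, which does not involve \<open>t\<close>.  In the weak form this is
  done by testing the formula with \<open>T\<^sub>0(t) y\<close> and using that \<open>T\<^sub>0\<close> preserves inner products.
\<close>

lemma damped_trajectory_of_evolution_family: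
  fixes T0 :: "real \<Rightarrow> 'x::complex_hilbert_space \<Rightarrow>\<^sub>L 'x"
    and B :: "real \<Rightarrow> 'v::complex_hilbert_space \<Rightarrow>\<^sub>L 'x"
  assumes T0: "unitary_group T0" and B: "L2_loc B" and U: "associated_evolution_family T0 B U"
    and \<tau>: "0 \<le> \<tau>"
  shows "damped_trajectory \<tau> (\<lambda>s y. blinfun_apply (cadjoint (B s)) (blinfun_apply (T0 s) y))
    (\<lambda>s. norm (B s)) (\<lambda>t. blinfun_apply (T0 (- t)) (blinfun_apply (U t 0) x))"
proof (rule damped_trajectory.intro)
  let ?D = "\<lambda>s. blinfun_apply (cadjoint (B s))"
  let ?z = "\<lambda>t. blinfun_apply (U t 0) x"
  have linB: "complex_linear (B s)" if "0 \<le> s" for s using B that by (simp add: L2_loc_def)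
  have zero: "T0 0 = id_blinfun" "U 0 0 = id_blinfun"
    using T0 U by (auto simp: unitary_group_def associated_evolution_family_def evolution_family_def)
  have unitary: "inner (blinfun_apply (T0 t) u) (blinfun_apply (T0 t) v) = inner u v" for t u v
    using T0 by (simp add: inner_unitary unitary_group_def)
  show "0 \<le> \<tau>" by (rule \<tau>)
  show "linear (\<lambda>y. ?D s (blinfun_apply (T0 s) y))" for s
    by (intro bounded_linear.linear bounded_linear_intros)
  show "norm (?D s (blinfun_apply (T0 s) y)) \<le> norm (B s) * norm y" if "s \<in> {0..\<tau>}" for s y
    using norm_cadjoint_apply_le[OF linB, of s "blinfun_apply (T0 s) y"] that
    by (simp add: norm_unitary_group[OF T0])
  show "(\<lambda>s. (norm (B s))\<^sup>2) integrable_on {0..\<tau>}"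
    using B \<tau> by (auto simp: L2_loc_def intro: set_lebesgue_integral_eq_integral(1))
  show "(\<lambda>s. (norm (?D s (blinfun_apply (T0 s) (p s))))\<^sup>2) integrable_on {0..\<tau>}"
    if "continuous_on {0..\<tau>} p" for p
    by (intro cadjoint_square_integrable[OF B \<tau>] continuous_on_unitary_group[OF T0] that
        continuous_on_id)
  have "continuous_on {(t, s). 0 \<le> s \<and> s \<le> t} (\<lambda>(t, s). blinfun_apply (U t s) x)"
    using U by (simp add: associated_evolution_family_def evolution_family_def)
  then have "continuous_on {0..\<tau>} (\<lambda>t. (\<lambda>(t, s). blinfun_apply (U t s) x) (t, 0))"
    by (rule continuous_on_compose2) (auto intro!: continuous_intros)
  then show "continuous_on {0..\<tau>} (\<lambda>t. blinfun_apply (T0 (- t)) (?z t))"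
    by (intro continuous_on_unitary_group[OF T0] continuous_on_minus continuous_on_id) simp
  fix t y assume t: "t \<in> {0..\<tau>}"
  then have "0 \<le> t" by simp
  with U[unfolded associated_evolution_family_def, THEN conjunct2, THEN conjunct2,
      THEN spec[of _ x], THEN spec[of _ t], THEN mp]
  obtain I where I: "((\<lambda>s. blinfun_apply (T0 (t - s) o\<^sub>L B s o\<^sub>L cadjoint (B s)) (?z s))
      has_integral I) {0..t}" and It: "?z t = blinfun_apply (T0 t) x - I"
    by blast
  have weak: "((\<lambda>s. inner (blinfun_apply (T0 (t - s) o\<^sub>L B s o\<^sub>L cadjoint (B s)) (?z s))
      (blinfun_apply (T0 t) y)) has_integral inner I (blinfun_apply (T0 t) y)) {0..t}"
    using has_integral_linear[OF I bounded_linear_inner_left, of "blinfun_apply (T0 t) y"]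
    by (simp add: o_def)
  have weak_value: "inner I (blinfun_apply (T0 t) y)
      = inner (blinfun_apply (T0 (- 0)) (?z 0) - blinfun_apply (T0 (- t)) (?z t)) y"
  proof -
    have "inner (blinfun_apply (T0 (- t)) (?z t)) y = inner (?z t) (blinfun_apply (T0 t) y)"
      using unitary[of t "blinfun_apply (T0 (- t)) (?z t)" y] by (simp add: unitary_group_inverse[OF T0])
    then show ?thesis by (simp add: It zero inner_diff_left unitary)
  qed
  have integrand: "inner (blinfun_apply (T0 (t - s) o\<^sub>L B s o\<^sub>L cadjoint (B s)) (?z s))
        (blinfun_apply (T0 t) y)
      = inner (?D s (blinfun_apply (T0 s) (blinfun_apply (T0 (- s)) (?z s))))
        (?D s (blinfun_apply (T0 s) y))"
    if s: "s \<in> {0..t}" for s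
  proof -
    have "T0 t = T0 (t - s) o\<^sub>L T0 s" using T0 unfolding unitary_group_def by (metis diff_add_cancel)
    then show ?thesis using s
      by (simp add: unitary unitary_group_inverse[OF T0] inner_cadjoint linB)
  qed
  show "((\<lambda>s. inner (?D s (blinfun_apply (T0 s) (blinfun_apply (T0 (- s)) (?z s))))
      (?D s (blinfun_apply (T0 s) y))) has_integral
      inner (blinfun_apply (T0 (- 0)) (?z 0) - blinfun_apply (T0 (- t)) (?z t)) y) {0..t}"
    using has_integral_eq[OF integrand weak] by (simp only: weak_value)
qed

theorem proposition3p4:
  fixes T0 :: "real \<Rightarrow> 'x::complex_hilbert_space \<Rightarrow>\<^sub>L 'x"
    and A0 :: "('x \<times> 'x) set"
    and A :: "real \<Rightarrow> ('x \<times> 'x) set"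
    and B :: "real \<Rightarrow> 'v::complex_hilbert_space \<Rightarrow>\<^sub>L 'x"
    and U :: "real \<Rightarrow> real \<Rightarrow> 'x \<Rightarrow>\<^sub>L 'x"
    and T :: "'x \<Rightarrow>\<^sub>L 'x"
    and \<tau> :: real
  assumes "unitary_group T0"
    and "A0 = group_generator T0"
    and "L2_loc B"
    and "\<And>t. t \<ge> 0 \<Longrightarrow> A t = perturbed_generator A0 B t"
    and "associated_evolution_family T0 B U"
    and "\<tau> > 0"
    and "T0 \<tau> = id_blinfun"
    and "T = U \<tau> 0"
  shows "ritt_operator T \<and>
    fixed_space T =
      {x. integral {0..\<tau>}
            (\<lambda>t. (norm (blinfun_apply (cadjoint (B t)) (blinfun_apply (T0 t) x)))\<^sup>2) = 0} \<and>
    spectrum T \<inter> sphere 0 1 \<subseteq> {1} \<and>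
    (1 \<notin> point_spectrum T \<longleftrightarrow> approximately_observable B T0 \<tau>)"
proof -
  note T0 = assms(1) and B = assms(3) and U = assms(5)
  have \<tau>: "0 \<le> \<tau>" using assms(6) by simp
  let ?C = "\<lambda>s y. blinfun_apply (cadjoint (B s)) (blinfun_apply (T0 s) y)"
  let ?w = "\<lambda>x t. blinfun_apply (T0 (- t)) (blinfun_apply (U t 0) x)"
  have traj: "damped_trajectory \<tau> ?C (\<lambda>s. norm (B s)) (?w x)" for x
    using T0 B U \<tau> by (rule damped_trajectory_of_evolution_family)
  have start: "?w x 0 = x" for x
    using T0 U by (simp add: unitary_group_def associated_evolution_family_def evolution_family_def)
  have finish: "?w x \<tau> = blinfun_apply T x" for x
    using unitary_group_inverse[OF T0, of \<tau> "blinfun_apply T x"] assms(7,8) by simp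
  define M where "M = 1 + (damped_trajectory.gain \<tau> (\<lambda>s. norm (B s)))\<^sup>2"
  have lin: "complex_linear T" and contraction: "norm T \<le> 1"
    using U \<tau> assms(8) by (auto simp: associated_evolution_family_def evolution_family_def)
  have defect: "inner (x - blinfun_apply T x) (c *\<^sub>C x)
      \<le> M * ((norm x)\<^sup>2 - (norm (blinfun_apply T x))\<^sup>2)" if c: "cmod c = 1" for x c
  proof -
    have "norm (?C s (c *\<^sub>C x)) = norm (?C s (?w x 0))" if "s \<in> {0..\<tau>}" for s
    proof -
      have "complex_linear (T0 s)" "complex_linear (B s)"
        using T0 B that by (auto simp: unitary_group_def unitary_operator_def L2_loc_def)
      then have "?C s (c *\<^sub>C x) = c *\<^sub>C ?C s x"
        by (simp add: complex_linear_def[of "T0 s"] cadjoint_scaleC)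
      then show ?thesis by (simp only: norm_scaleC c start)
    qed
    from damped_trajectory.loss_controls_defect[OF traj this]
    show ?thesis by (simp only: start finish M_def)
  qed
  have "M \<ge> 0" by (simp add: M_def)
  note ritt = ritt_operator_if_loss_controls_defect[OF lin this contraction defect]
  have fixed: "blinfun_apply T x = x \<longleftrightarrow> integral {0..\<tau>} (\<lambda>s. (norm (?C s x))\<^sup>2) = 0" for x
    using damped_trajectory.returns_iff_unobserved[OF traj, of x] by (simp only: start finish)
  have "fixed_space T = {x. integral {0..\<tau>} (\<lambda>s. (norm (?C s x))\<^sup>2) = 0}"
    by (auto simp: fixed_space_def blinfun.diff_left simp flip: fixed)
  moreover have "1 \<notin> point_spectrum T \<longleftrightarrow> approximately_observable B T0 \<tau>"
    by (auto simp: point_spectrum_def approximately_observable_def scaleC_1 simp flip: fixed)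
  ultimately show ?thesis using ritt by blast
qed

end
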